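(* Let $n\ge 1$, let $f:\{0,1\}^n\to\{0,1\}$ be a Boolean function, and let $U_f$ be its quantum function oracle, which preserves phase information: $$U_f\sum_{x,y}c_{x,y}|x,y\rangle=\sum_{x,y}c_{x,y}|x,y+f(x)\rangle$$ for all complex coefficients $c_{x,y}$ ($x\in\{0,1\}^n$, $y\in\{0,1\}$). Then the pair of maps induced by $U_f$ in the computational basis and in the phase basis, respectively, is given by the conjugate pair oracle $$\mathcal F\bigl([x,\chi],[y,\upsilon]\bigr)=\Bigl(\bigl[x,\chi+\check f(\upsilon)\bigr],\bigl[y+f(x),\upsilon\bigr]\Bigr),$$ where $\check f(\upsilon)$ is random with $$\check f(\upsilon)=\upsilon T,\qquad p(T=t)=\bigl|\delta_{t0}-2\widehat f(t)\bigr|^2\quad (t\in\{0,1\}^n).$$ That is: (i) if the input has well-defined computational values $x,y$, the output has well-defined computational values $x,\ y+f(x)$; (ii) if the input has well-defined phase values $\chi,\upsilon$, then reading the output in the phase basis gives $\chi+\upsilon T,\ \upsilon$, with $T$ distributed as stated. In particular $\check f(1)$ is a Fourier sample of $f$.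
   Context: All bit and bitstring additions are bitwise modulo 2, and $\cdot$ is the dot product modulo 2. $\delta_{t0}$ equals 1 if $t$ is the all-zero string and 0 otherwise. $\widehat f$ is the Hadamard (bitwise Fourier mod 2) transform of $f$ regarded as a $\{0,1\}$-valued real function, $\widehat f(t)=2^{-n}\sum_{x\in\{0,1\}^n}(-1)^{t\cdot x}f(x)$. A Fourier sample of $f$ is a sample from the squared-modulus distribution of the Hadamard transform of $(-1)^{f(x)}=1-2f(x)$. A conjugate pair $[x,\chi]$ of length $n$ is a pair of bitstrings of length $n$, describing an $n$-qubit register: $x$ is the computational basis coordinate and $\chi$ the phase basis coordinate. The computational coordinate is well-defined with value $x$ when the register is in the state $|x\rangle$; the phase coordinate is well-defined with value $\chi$ when the register is in the state $H^{\otimes n}|\chi\rangle$, where $H$ is the single-qubit Hadamard gate. The two coordinates are never both well-defined. Reading the computational (phase) coordinate means measuring in the basis $\{|x\rangle\}$ (respectively $\{H^{\otimes n}|\chi\rangle\}$). The control register is $[x,\chi]$ of length $n$ and the target register is $[y,\upsilon]$ of length 1. A conjugate pair oracle formula is read separately in the two bases, as spelled out in (i) and (ii). *)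

theory Defs
  imports "HOL-Probability.Probability" "HOL-Library.Z2"
begin

text \<open>
  Bits are elements of the two-element field \<open>bit\<close>, and bitstrings of length \<open>n = CARD('n)\<close> are
  vectors \<open>bit ^ 'n\<close>. Thus \<open>+\<close> is addition modulo 2 (bitwise on strings), and \<open>\<upsilon> *s t\<close> is the product of
  the bit \<open>\<upsilon>\<close> with the string \<open>t\<close>. A state of a register whose computational basis is labelled by the
  finite type \<open>'a\<close> is a vector in \<open>complex ^ 'a\<close>. A register of length 1 is labelled by \<open>bit\<close> itself.
\<close>

instance bit :: finite
proof
  have "(UNIV :: bit set) \<subseteq> {0, 1}"
    by (auto intro: bit.exhaust)
  then show "finite (UNIV :: bit set)"
    by (rule finite_subset) simp
qed

definition dot :: "bit ^ 'n \<Rightarrow> bit ^ 'n \<Rightarrow> bit"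
  where "dot s t = (\<Sum>i\<in>UNIV. s $ i * t $ i)"

definition hadamard_transform :: "(bit ^ 'n \<Rightarrow> real) \<Rightarrow> bit ^ 'n \<Rightarrow> real"
  where "hadamard_transform g t =
    (\<Sum>x\<in>UNIV. (- 1) ^ of_bit (dot t x) * g x) / 2 ^ CARD('n)"


subsection \<open>Quantum states\<close>

definition ket :: "'a \<Rightarrow> complex ^ 'a"
  where "ket a = axis a 1"

definition tensor :: "complex ^ 'a \<Rightarrow> complex ^ 'b \<Rightarrow> complex ^ ('a \<times> 'b)"
  where "tensor \<phi> \<psi> = (\<chi> p. \<phi> $ fst p * \<psi> $ snd p)"

definition hadamard_gate :: "complex ^ bit ^ bit"
  where "hadamard_gate = (\<chi> a b. (- 1) ^ of_bit (a * b) / complex_of_real (sqrt 2))"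

definition tensor_power :: "complex ^ bit ^ bit \<Rightarrow> complex ^ (bit ^ 'n) ^ (bit ^ 'n)"
  where "tensor_power A = (\<chi> x y. \<Prod>i\<in>UNIV. A $ (x $ i) $ (y $ i))"

definition comp_basis :: "(bit ^ 'n) \<times> bit \<Rightarrow> complex ^ ((bit ^ 'n) \<times> bit)"
  where "comp_basis = (\<lambda>(x, y). tensor (ket x) (ket y))"

definition phase_basis :: "(bit ^ 'n) \<times> bit \<Rightarrow> complex ^ ((bit ^ 'n) \<times> bit)"
  where "phase_basis = (\<lambda>(\<xi>, \<upsilon>).
    tensor (tensor_power hadamard_gate *v ket \<xi>) (hadamard_gate *v ket \<upsilon>))"

definition has_comp_values :: "complex ^ ((bit ^ 'n) \<times> bit) \<Rightarrow> (bit ^ 'n) \<times> bit \<Rightarrow> bool"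
  where "has_comp_values \<psi> v \<longleftrightarrow> \<psi> = comp_basis v"

definition has_phase_values :: "complex ^ ((bit ^ 'n) \<times> bit) \<Rightarrow> (bit ^ 'n) \<times> bit \<Rightarrow> bool"
  where "has_phase_values \<psi> v \<longleftrightarrow> \<psi> = phase_basis v"

text \<open>The Hermitian inner product; the class operation \<open>\<bullet>\<close> on complex vectors is only its real part.\<close>

definition hermitian_inner :: "complex ^ 'a \<Rightarrow> complex ^ 'a \<Rightarrow> complex"
  where "hermitian_inner \<phi> \<psi> = (\<Sum>a\<in>UNIV. cnj (\<phi> $ a) * \<psi> $ a)"

definition phase_reading_prob :: "complex ^ ((bit ^ 'n) \<times> bit) \<Rightarrow> (bit ^ 'n) \<times> bit \<Rightarrow> real"
  where "phase_reading_prob \<psi> v = (cmod (hermitian_inner (phase_basis v) \<psi>))\<^sup>2"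


subsection \<open>Conjugate pairs and the conjugate pair oracle\<close>

datatype 'a conj_pair = CPair (comp_coord: 'a) (phase_coord: 'a)

definition comp_coords :: "'a conj_pair \<times> 'b conj_pair \<Rightarrow> 'a \<times> 'b"
  where "comp_coords = map_prod comp_coord comp_coord"

definition phase_coords :: "'a conj_pair \<times> 'b conj_pair \<Rightarrow> 'a \<times> 'b"
  where "phase_coords = map_prod phase_coord phase_coord"

definition T_weight :: "(bit ^ 'n \<Rightarrow> bit) \<Rightarrow> bit ^ 'n \<Rightarrow> real"
  where "T_weight f t = \<bar>of_bool (t = 0) - 2 * hadamard_transform (\<lambda>x. of_bit (f x)) t\<bar>\<^sup>2"

text \<open>
  \<open>embed_pmf\<close> is meaningful only for weights that sum to 1, so whoever uses this has to establish
  \<open>pmf (T_pmf f) t = T_weight f t\<close>.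
\<close>

definition T_pmf :: "(bit ^ 'n \<Rightarrow> bit) \<Rightarrow> (bit ^ 'n) pmf"
  where "T_pmf f = embed_pmf (T_weight f)"

definition f_check :: "(bit ^ 'n \<Rightarrow> bit) \<Rightarrow> bit \<Rightarrow> (bit ^ 'n) pmf"
  where "f_check f \<upsilon> = map_pmf (\<lambda>t. \<upsilon> *s t) (T_pmf f)"

text \<open>The oracle is random only through the sample \<open>s\<close> of \<open>f_check f \<upsilon>\<close>.\<close>

fun conj_pair_oracle ::
  "(bit ^ 'n \<Rightarrow> bit) \<Rightarrow> (bit ^ 'n) conj_pair \<times> bit conj_pair \<Rightarrow>
    ((bit ^ 'n) conj_pair \<times> bit conj_pair) pmf"
  where "conj_pair_oracle f (CPair x \<xi>, CPair y \<upsilon>) =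
    map_pmf (\<lambda>s. (CPair x (\<xi> + s), CPair (y + f x) \<upsilon>)) (f_check f \<upsilon>)"

definition fourier_sample_prob :: "(bit ^ 'n \<Rightarrow> bit) \<Rightarrow> bit ^ 'n \<Rightarrow> real"
  where "fourier_sample_prob f t = \<bar>hadamard_transform (\<lambda>x. (- 1) ^ of_bit (f x)) t\<bar>\<^sup>2"

end

theory Submission
  imports Defs
begin

text \<open>
  Phase kickback: \<open>U\<close> multiplies the amplitude of the phase basis state \<open>(\<xi>, \<upsilon>)\<close> at \<open>(x, y)\<close> by
  \<open>(-1)\<close> to the power \<open>\<upsilon> * f x\<close>. Its inner product with the phase basis state \<open>(\<eta>, \<omega>)\<close> therefore
  vanishes unless \<open>\<omega> = \<upsilon>\<close>, and is then the Hadamard transform of that sign at \<open>\<eta> + \<xi>\<close>: a delta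
  for \<open>\<upsilon> = 0\<close>, and the Fourier amplitude of \<open>f\<close> for \<open>\<upsilon> = 1\<close>. Parseval shows that the squared
  Fourier amplitudes sum to 1, so that they define the distribution of \<open>T\<close>.
\<close>

text \<open>These simp rules rewrite ring expressions over \<open>bit\<close> into bit operations and cardinality parities.\<close>

declare add_bit_eq_xor [simp del] mult_bit_eq_and [simp del]

text \<open>The sign character of \<open>bit\<close>, polymorphic so that the real Hadamard
  transform and the complex amplitudes share one set of rules.\<close>

definition bit_sign :: "bit \<Rightarrow> 'a::comm_ring_1"
  where "bit_sign b = (- 1) ^ of_bit b"

lemma bit_sign_0 [simp]: "bit_sign 0 = 1"
  and bit_sign_1 [simp]: "bit_sign 1 = - 1"
  by (simp_all add: bit_sign_def)

lemma bit_sign_add: "bit_sign (a + b) = bit_sign a * bit_sign b"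
  by (cases a; cases b) simp_all

lemma bit_sign_sum: "bit_sign (sum g A) = (\<Prod>i\<in>A. bit_sign (g i))"
  by (induction A rule: infinite_finite_induct) (simp_all add: bit_sign_add)

lemma bit_sign_mult_self [simp]: "bit_sign b * bit_sign b = 1"
  by (cases b) simp_all

lemma bit_sign_power2 [simp]: "(bit_sign b)\<^sup>2 = 1"
  by (simp add: power2_eq_square)

lemma of_real_bit_sign [simp]: "of_real (bit_sign b) = bit_sign b"
  by (cases b) simp_all

lemma cnj_bit_sign [simp]: "cnj (bit_sign b) = bit_sign b"
  by (cases b) simp_all

lemma bit_sign_eq_real: "bit_sign b = 1 - 2 * (of_bit b :: real)"
  by (cases b) simp_all

section \<open>Bit strings and the dot product modulo 2\<close>

lemma UNIV_bit: "(UNIV :: bit set) = {0, 1}"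
  by (auto intro: bit.exhaust)

lemma bit_vec_add_self [simp]: "x + x = (0 :: bit ^ 'n)"
  by (simp add: vec_eq_iff)

lemma bit_vec_add_self_left [simp]: "x + (x + y) = (y :: bit ^ 'n)"
  by (simp flip: add.assoc)

lemma bit_vec_add_eq_0_iff: "x + y = 0 \<longleftrightarrow> x = (y :: bit ^ 'n)"
  by (metis add.right_neutral bit_vec_add_self bit_vec_add_self_left)

lemma card_bit_vec: "CARD(bit ^ 'n) = 2 ^ CARD('n::finite)"
proof -
  have "CARD(bit) = 2" by (simp add: UNIV_bit)
  then show ?thesis by (simp only: CARD_vec)
qed

lemma dot_commute: "dot s t = dot t s"
  by (simp add: dot_def mult.commute)

lemma dot_add_right: "dot s (t + u) = dot s t + dot s u"
  by (simp add: dot_def distrib_left sum.distrib)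

lemma dot_add_left: "dot (s + t) u = dot s u + dot t u"
  by (simp add: dot_def distrib_right sum.distrib)

lemma dot_0_left [simp]: "dot 0 t = 0"
  by (simp add: dot_def)

lemma dot_axis: "dot t (axis i 1) = t $ i"
proof -
  have "dot t (axis i 1) = (\<Sum>j\<in>UNIV. if j = i then t $ i else 0)"
    unfolding dot_def by (rule sum.cong) (auto simp: axis_def)
  then show ?thesis by simp
qed

text \<open>Orthogonality of characters: if \<open>t\<close> has a 1 at \<open>i\<close>,
  translating \<open>x\<close> by the \<open>i\<close>-th unit vector flips every sign, so the sum
  equals its own negative.\<close>

lemma sum_bit_sign_dot:
  fixes t :: "bit ^ 'n"
  shows "(\<Sum>x\<in>UNIV. bit_sign (dot t x) :: real) = (if t = 0 then 2 ^ CARD('n) else 0)"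
proof (cases "t = 0")
  case True
  then show ?thesis by (simp add: card_bit_vec del: CARD_vec)
next
  case False
  then obtain i where "t $ i \<noteq> 0" by (auto simp: vec_eq_iff)
  then have i: "t $ i = 1" by (cases "t $ i") simp_all
  have "(\<Sum>x\<in>UNIV. bit_sign (dot t x) :: real) = (\<Sum>x\<in>UNIV. bit_sign (dot t (axis i 1 + x)))"
    by (rule sum.reindex_bij_witness[of _ "(+) (axis i 1)" "(+) (axis i 1)"]) simp_all
  also have "\<dots> = - (\<Sum>x\<in>UNIV. bit_sign (dot t x))"
    by (simp add: dot_add_right bit_sign_add dot_axis i sum_negf)
  finally show ?thesis using False by simp
qed

section \<open>The Hadamard transform and the distribution of T\<close>

lemma hadamard_transform_bit_sign:
  "hadamard_transform g t = (\<Sum>x\<in>UNIV. bit_sign (dot t x) * g x) / 2 ^ CARD('n)"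
  for t :: "bit ^ 'n"
  by (simp add: hadamard_transform_def bit_sign_def)

lemma hadamard_transform_one: "hadamard_transform (\<lambda>x. 1) t = of_bool (t = 0)"
  by (simp add: hadamard_transform_bit_sign sum_bit_sign_dot)

text \<open>By linearity from \<open>(- 1) ^ b = 1 - 2 * b\<close>; this turns the formula in
  \<open>T_weight\<close> into a Fourier amplitude.\<close>

lemma hadamard_transform_sign_function:
  "hadamard_transform (\<lambda>x. bit_sign (f x)) t =
    of_bool (t = 0) - 2 * hadamard_transform (\<lambda>x. of_bit (f x)) t"
proof -
  have "hadamard_transform (\<lambda>x. 1 - 2 * h x) t =
      hadamard_transform (\<lambda>x. 1) t - 2 * hadamard_transform h t" for h
    unfolding hadamard_transform_bit_sign
    by (simp add: right_diff_distrib sum_subtractf diff_divide_distrib sum_distrib_left mult.left_commute)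
  then show ?thesis by (simp add: bit_sign_eq_real hadamard_transform_one)
qed

text \<open>Expand the square over pairs \<open>x\<close>, \<open>y\<close> and sum over
  \<open>t\<close> first; orthogonality of characters leaves only the diagonal.\<close>

lemma hadamard_transform_parseval:
  fixes g :: "bit ^ 'n \<Rightarrow> real"
  shows "(\<Sum>t\<in>UNIV. (hadamard_transform g t)\<^sup>2) = (\<Sum>x\<in>UNIV. (g x)\<^sup>2) / 2 ^ CARD('n)"
proof -
  let ?N = "2 ^ CARD('n) :: real"
  have "(\<Sum>t\<in>UNIV. (\<Sum>x\<in>UNIV. bit_sign (dot t x) * g x)\<^sup>2) =
      (\<Sum>t\<in>UNIV. \<Sum>x\<in>UNIV. \<Sum>y\<in>UNIV. bit_sign (dot t (x + y)) * (g x * g y))"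
    by (simp add: power2_eq_square sum_product dot_add_right bit_sign_add ac_simps)
  also have "\<dots> = (\<Sum>x\<in>UNIV. \<Sum>y\<in>UNIV. \<Sum>t\<in>UNIV. bit_sign (dot t (x + y)) * (g x * g y))"
    by (subst sum.swap, rule sum.cong[OF refl], rule sum.swap)
  also have "\<dots> = (\<Sum>x\<in>UNIV. \<Sum>y\<in>UNIV. (if x = y then ?N * (g x * g y) else 0))"
    \<comment> \<open>\<open>dot_commute\<close> moves \<open>x + y\<close> into the frequency slot,
      so that the orthogonality sum runs over \<open>t\<close>.\<close>
    by (intro sum.cong refl) (simp add: dot_commute[of _ "_ + _"] sum_bit_sign_dot bit_vec_add_eq_0_iff flip: sum_distrib_right)
  also have "\<dots> = ?N * (\<Sum>x\<in>UNIV. (g x)\<^sup>2)"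
    by (simp add: sum_distrib_left power2_eq_square)
  finally show ?thesis
    by (simp add: hadamard_transform_bit_sign power_divide power2_eq_square flip: sum_divide_distrib)
qed

lemma T_weight_eq: "T_weight f t = (hadamard_transform (\<lambda>x. bit_sign (f x)) t)\<^sup>2"
  by (simp add: T_weight_def hadamard_transform_sign_function)

text \<open>Parseval for a function with values 1 and -1, whose mean square is 1.\<close>

lemma sum_T_weight: "(\<Sum>t\<in>UNIV. T_weight f t) = 1" for f :: "bit ^ 'n \<Rightarrow> bit"
  by (simp add: T_weight_eq hadamard_transform_parseval card_bit_vec del: CARD_vec)

text \<open>The side conditions of \<open>embed_pmf\<close> hold: the weights are squares and sum to
  1.\<close>

lemma pmf_T_pmf: "pmf (T_pmf f) t = T_weight f t" for f :: "bit ^ 'n \<Rightarrow> bit"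
  unfolding T_pmf_def
proof (rule pmf_embed_pmf)
  show nonneg: "0 \<le> T_weight f t" for t by (simp add: T_weight_eq)
  show "(\<integral>\<^sup>+t. ennreal (T_weight f t) \<partial>count_space UNIV) = 1"
    by (simp add: nn_integral_count_space_finite sum_ennreal nonneg sum_T_weight)
qed

section \<open>Amplitudes in the two bases\<close>

lemma bit_add_self_right: "y + b + b = (y :: bit)"
  by (cases b; cases y) simp_all

lemma comp_basis_nth: "comp_basis p $ q = of_bool (p = q)"
  by (cases p; cases q) (simp add: comp_basis_def tensor_def ket_def axis_def)

text \<open>Lets the hypothesis on \<open>U\<close>, stated for explicit superpositions, be applied
  to an arbitrary state.\<close>

lemma comp_basis_expansion: "(\<Sum>x\<in>UNIV. \<Sum>y\<in>UNIV. \<psi> $ (x, y) *s comp_basis (x, y)) = \<psi>"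
proof -
  have "(\<Sum>x\<in>UNIV. \<Sum>y\<in>UNIV. \<psi> $ (x, y) *s comp_basis (x, y)) =
      (\<Sum>p\<in>UNIV. \<psi> $ p *s comp_basis p)"
    by (simp add: sum.cartesian_product UNIV_Times_UNIV split_def)
  also have "\<dots> = \<psi>"
    by (simp add: vec_eq_iff sum_component comp_basis_nth of_bool_def if_distrib cong: if_cong)
  finally show ?thesis .
qed

text \<open>Adding \<open>f x\<close> is an involution in \<open>y\<close>, so shifting the basis
  labels amounts to the same shift inside the amplitudes.\<close>

lemma function_oracle_nth:
  fixes f :: "bit ^ 'n \<Rightarrow> bit"
    and U :: "complex ^ ((bit ^ 'n) \<times> bit) \<Rightarrow> complex ^ ((bit ^ 'n) \<times> bit)"
  assumes U: "\<And>c :: bit ^ 'n \<Rightarrow> bit \<Rightarrow> complex.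
    U (\<Sum>x\<in>UNIV. \<Sum>y\<in>UNIV. c x y *s comp_basis (x, y)) =
      (\<Sum>x\<in>UNIV. \<Sum>y\<in>UNIV. c x y *s comp_basis (x, y + f x))"
  shows "U \<psi> $ (x, y) = \<psi> $ (x, y + f x)"
proof -
  have "U \<psi> = (\<Sum>x\<in>UNIV. \<Sum>y\<in>UNIV. \<psi> $ (x, y) *s comp_basis (x, y + f x))"
    using U[of "\<lambda>x y. \<psi> $ (x, y)"] by (simp add: comp_basis_expansion)
  also have "\<dots> = (\<Sum>x\<in>UNIV. \<Sum>y\<in>UNIV. \<psi> $ (x, y + f x) *s comp_basis (x, y))"
  proof (rule sum.cong[OF refl])
    show "(\<Sum>y\<in>UNIV. \<psi> $ (x, y) *s comp_basis (x, y + f x)) =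
        (\<Sum>y\<in>UNIV. \<psi> $ (x, y + f x) *s comp_basis (x, y))" for x
      by (rule sum.reindex_bij_witness[of _ "\<lambda>y. y + f x" "\<lambda>y. y + f x"])
        (simp_all add: bit_add_self_right)
  qed
  also have "\<dots> = (\<chi> p. \<psi> $ (fst p, snd p + f (fst p)))"
    using comp_basis_expansion[of "\<chi> p. \<psi> $ (fst p, snd p + f (fst p))"] by simp
  finally show ?thesis by simp
qed

text \<open>\<open>bit_sign\<close> turns the sum in the dot product into the product over qubits of
  the tensor power; each of the n + 1 gates contributes one factor
  \<open>1 / sqrt 2\<close>.\<close>

lemma phase_basis_nth:
  fixes \<xi> :: "bit ^ 'n"
  shows "phase_basis (\<xi>, \<upsilon>) $ (x, y) =
    bit_sign (dot \<xi> x) * bit_sign (\<upsilon> * y) / complex_of_real (sqrt 2 ^ CARD('n) * sqrt 2)"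
proof -
  have ket: "(A *v ket a) $ b = A $ b $ a" for A :: "complex ^ 'a ^ 'b" and a b
    by (simp add: ket_def matrix_vector_mult_def axis_def
        if_distrib cong: if_cong)
  have gate: "hadamard_gate $ a $ b = bit_sign (b * a) / complex_of_real (sqrt 2)" for a b
    unfolding hadamard_gate_def bit_sign_def by (simp add: mult.commute)
  show ?thesis
    by (simp add: phase_basis_def tensor_def ket tensor_power_def gate dot_def bit_sign_sum prod_dividef)
qed

lemma hermitian_inner_oracle_phase:
  fixes f :: "bit ^ 'n \<Rightarrow> bit"
    and U :: "complex ^ ((bit ^ 'n) \<times> bit) \<Rightarrow> complex ^ ((bit ^ 'n) \<times> bit)"
  assumes U: "\<And>\<psi> x y. U \<psi> $ (x, y) = \<psi> $ (x, y + f x)"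
  shows "hermitian_inner (phase_basis (\<eta>, \<omega>)) (U (phase_basis (\<xi>, \<upsilon>))) =
    complex_of_real (of_bool (\<omega> = \<upsilon>) * hadamard_transform (\<lambda>x. bit_sign (\<upsilon> * f x)) (\<eta> + \<xi>))"
proof -
  let ?s = "complex_of_real (sqrt 2 ^ CARD('n) * sqrt 2)"
  \<comment> \<open>In the resulting \<open>2 ^ CARD('n) * 2\<close>, the power normalises the
    Hadamard transform and the last 2 cancels against the sum over \<open>y\<close>.\<close>
  have "(sqrt 2 ^ CARD('n) * sqrt 2) * (sqrt 2 ^ CARD('n) * sqrt 2) =
      (sqrt 2 * sqrt 2) ^ CARD('n) * (sqrt 2 * sqrt 2)"
    by (simp only: power_mult_distrib mult_ac)
  then have s: "?s * ?s = of_real (2 ^ CARD('n)) * 2"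
    by (simp only: of_real_mult [symmetric]) simp
  have "hermitian_inner (phase_basis (\<eta>, \<omega>)) (U (phase_basis (\<xi>, \<upsilon>))) =
      (\<Sum>x\<in>UNIV. \<Sum>y\<in>UNIV. cnj (phase_basis (\<eta>, \<omega>) $ (x, y)) * U (phase_basis (\<xi>, \<upsilon>)) $ (x, y))"
    by (simp add: hermitian_inner_def sum.cartesian_product UNIV_Times_UNIV split_def)
  also have "\<dots> = (\<Sum>x\<in>UNIV. \<Sum>y\<in>UNIV.
      (bit_sign (dot (\<eta> + \<xi>) x) * bit_sign (\<upsilon> * f x)) * bit_sign ((\<omega> + \<upsilon>) * y) / (?s * ?s))"
    \<comment> \<open>Kickback: expanding \<open>\<upsilon> * (y + f x)\<close> splits off a sign
      independent of \<open>y\<close>, so that the double sum factors.\<close>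
    by (intro sum.cong refl)
      (simp add: U phase_basis_nth dot_add_left distrib_left distrib_right bit_sign_add del: of_real_mult)
  also have "\<dots> = (\<Sum>x\<in>UNIV. bit_sign (dot (\<eta> + \<xi>) x) * bit_sign (\<upsilon> * f x)) *
      (\<Sum>y\<in>UNIV. bit_sign ((\<omega> + \<upsilon>) * y)) / (?s * ?s)"
    by (simp only: sum_product sum_divide_distrib)
  also have "(\<Sum>y\<in>UNIV. bit_sign ((\<omega> + \<upsilon>) * y)) = (2 * of_bool (\<omega> = \<upsilon>) :: complex)"
    by (cases \<omega>; cases \<upsilon>) (simp_all add: UNIV_bit)
  finally show ?thesis
    unfolding s by (simp add: hadamard_transform_bit_sign)
qed

text \<open>For \<open>\<upsilon> = 0\<close> the distribution is a point mass, matching the delta;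
  for \<open>\<upsilon> = 1\<close> the map is injective and carries the masses of
  \<open>T_pmf f\<close> over unchanged.\<close>

lemma pmf_map_phase_shift:
  fixes f :: "bit ^ 'n \<Rightarrow> bit"
  shows "pmf (map_pmf (\<lambda>t. (\<xi> + \<upsilon> *s t, \<upsilon>)) (T_pmf f)) (\<eta>, \<omega>) =
    (of_bool (\<omega> = \<upsilon>) * hadamard_transform (\<lambda>x. bit_sign (\<upsilon> * f x)) (\<eta> + \<xi>))\<^sup>2"
proof (cases "\<upsilon> = 0")
  case True
  then show ?thesis
    by (auto simp: hadamard_transform_one bit_vec_add_eq_0_iff map_pmf_const pmf_return indicator_def)
next
  case False
  then have 1: "\<upsilon> = 1" by simp
  have inj: "inj (\<lambda>t. (\<xi> + t, 1 :: bit))" by (auto intro: injI)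
  show ?thesis
  proof (cases "\<omega> = 1")
    case True
    \<comment> \<open>The preimage of \<open>\<eta>\<close> is \<open>\<eta> + \<xi>\<close> because
      \<open>\<xi> + \<xi> = 0\<close>.\<close>
    have "(\<eta>, \<omega>) = (\<lambda>t. (\<xi> + t, 1)) (\<eta> + \<xi>)"
      using True by (simp add: add.left_commute[of \<xi>])
    then show ?thesis
      using 1 True pmf_map_inj'[OF inj, of "T_pmf f" "\<eta> + \<xi>"]
      by (simp add: pmf_T_pmf T_weight_eq)
  next
    case False
    then show ?thesis
      using 1 by (auto simp: pmf_eq_0_set_pmf)
  qed
qed

section \<open>Marginals of the conjugate pair oracle and the conclusion\<close>

lemma map_comp_coords_oracle:
  "map_pmf comp_coords (conj_pair_oracle f (CPair x \<xi>, CPair y \<upsilon>)) = return_pmf (x, y + f x)"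
  by (simp add: comp_coords_def pmf.map_comp o_def map_pmf_const)

lemma map_phase_coords_oracle:
  "map_pmf phase_coords (conj_pair_oracle f (CPair x \<xi>, CPair y \<upsilon>)) =
    map_pmf (\<lambda>t. (\<xi> + \<upsilon> *s t, \<upsilon>)) (T_pmf f)"
  by (simp add: phase_coords_def f_check_def pmf.map_comp o_def)

theorem theorem1:
  fixes f :: "bit ^ 'n \<Rightarrow> bit"
    and U :: "complex ^ ((bit ^ 'n) \<times> bit) \<Rightarrow> complex ^ ((bit ^ 'n) \<times> bit)"
  assumes U: "\<And>c :: bit ^ 'n \<Rightarrow> bit \<Rightarrow> complex.
    U (\<Sum>x\<in>UNIV. \<Sum>y\<in>UNIV. c x y *s comp_basis (x, y)) =
      (\<Sum>x\<in>UNIV. \<Sum>y\<in>UNIV. c x y *s comp_basis (x, y + f x))"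
  shows "(\<forall>t. pmf (T_pmf f) t =
          \<bar>of_bool (t = 0) - 2 * hadamard_transform (\<lambda>x. of_bit (f x)) t\<bar>\<^sup>2)
    \<and> (\<forall>x \<xi> y \<upsilon> \<psi>. has_comp_values \<psi> (x, y) \<longrightarrow>
          has_comp_values (U \<psi>) (x, y + f x)
        \<and> map_pmf comp_coords (conj_pair_oracle f (CPair x \<xi>, CPair y \<upsilon>)) =
            return_pmf (x, y + f x))
    \<and> (\<forall>x \<xi> y \<upsilon> \<psi>. has_phase_values \<psi> (\<xi>, \<upsilon>) \<longrightarrow>
          (\<forall>v. phase_reading_prob (U \<psi>) v =
            pmf (map_pmf phase_coords (conj_pair_oracle f (CPair x \<xi>, CPair y \<upsilon>))) v)
        \<and> map_pmf phase_coords (conj_pair_oracle f (CPair x \<xi>, CPair y \<upsilon>)) =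
            map_pmf (\<lambda>t. (\<xi> + \<upsilon> *s t, \<upsilon>)) (T_pmf f))
    \<and> (\<forall>t. pmf (f_check f 1) t = fourier_sample_prob f t)"
proof (intro conjI allI impI)
  note U_nth = function_oracle_nth[where U = U, OF U]
  show "pmf (T_pmf f) t = \<bar>of_bool (t = 0) - 2 * hadamard_transform (\<lambda>x. of_bit (f x)) t\<bar>\<^sup>2" for t
    by (simp add: pmf_T_pmf T_weight_def)
  show "pmf (f_check f 1) t = fourier_sample_prob f t" for t
    by (simp add: f_check_def pmf_T_pmf T_weight_eq fourier_sample_prob_def bit_sign_def)
  show "has_comp_values (U \<psi>) (x, y + f x)" if "has_comp_values \<psi> (x, y)" for x y \<psi>
  proof -
    have "U (comp_basis (x, y)) $ (a, b) = comp_basis (x, y + f x) $ (a, b)" for a b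
      by (auto simp: U_nth comp_basis_nth bit_add_self_right)
    then have "U (comp_basis (x, y)) = comp_basis (x, y + f x)"
      unfolding vec_eq_iff split_paired_All by blast
    then show ?thesis using that by (simp add: has_comp_values_def)
  qed
  show "phase_reading_prob (U \<psi>) v =
      pmf (map_pmf phase_coords (conj_pair_oracle f (CPair x \<xi>, CPair y \<upsilon>))) v"
    if "has_phase_values \<psi> (\<xi>, \<upsilon>)" for x \<xi> y \<upsilon> \<psi> v
    \<comment> \<open>The amplitude is real, so its squared modulus is the plain square in
      \<open>pmf_map_phase_shift\<close>.\<close>
    using that
    by (cases v) (simp only: has_phase_values_def phase_reading_prob_def map_phase_coords_oracle
        hermitian_inner_oracle_phase[OF U_nth] pmf_map_phase_shift norm_of_real power2_abs)
qed (rule map_comp_coords_oracle map_phase_coords_oracle)+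

end
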